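(* (a) $L_C^+(3)\geq\frac{57}{1000}$ and $L_C^-(3)\geq\frac{7}{125}$, so $R_C^+(3)>1.15455$ and $R_C^-(3)>1.14775$. (b) $L_C^+(4)\geq L_C^-(4)\geq\frac{25}{3456}$, so $R_C^+(4)\geq R_C^-(4)>1.16654$. (c) $L_C^+(5)\geq L_C^-(5)\geq\frac{109}{134456}$, so $R_C^+(5)\geq R_C^-(5)>1.20431$.
   Context: A circulant graph is a Cayley graph $\mathrm{Cay}(\mathbb{Z}_n,S)$ of a cyclic group ($0\notin S$, vertex $g$ joined to $g+s$ for $s\in S$); it is undirected if $S=-S$. $CC(d,k)$ denotes the largest order of an undirected circulant graph with degree $d$ and diameter $k$. Define $L^-_C(k)=\liminf_{d\to\infty}CC(d,k)/d^k$, $L^+_C(k)=\limsup_{d\to\infty}CC(d,k)/d^k$, $R^-_C(k)=k\,L^-_C(k)^{1/k}$ and $R^+_C(k)=k\,L^+_C(k)^{1/k}$. *)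

theory Defs
  imports
    "HOL-Analysis.Analysis"
    "HOL-Algebra.Elementary_Groups"
    "Graph_Theory.Graph_Theory"
begin

definition cayley_graph :: "('a, 'b) monoid_scheme \<Rightarrow> 'a set \<Rightarrow> ('a, 'a \<times> 'a) pre_digraph" where
  "cayley_graph G S =
     with_proj \<lparr> pverts = carrier G,
                 parcs = {(g, g \<otimes>\<^bsub>G\<^esub> s) | g s. g \<in> carrier G \<and> s \<in> S} \<rparr>"

text \<open>
  Directed graphs with symmetric arc set represent undirected graphs: an edge is a pair of
  opposite arcs, so the degree of a vertex is its out-degree.  The library's
  \<^const>\<open>integer_mod_group\<close> is infinite cyclic at \<open>n = 0\<close>, hence the condition \<open>n > 0\<close>.
\<close>

definition undirected_circulant_graph :: "nat \<Rightarrow> (int, int \<times> int) pre_digraph \<Rightarrow> bool" where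
  "undirected_circulant_graph n G \<longleftrightarrow>
     n > 0 \<and>
     (\<exists>S. S \<subseteq> carrier (integer_mod_group n) \<and>
          \<one>\<^bsub>integer_mod_group n\<^esub> \<notin> S \<and>
          (\<lambda>s. inv\<^bsub>integer_mod_group n\<^esub> s) ` S = S \<and>
          G = cayley_graph (integer_mod_group n) S)"

definition has_degree :: "('a, 'b) pre_digraph \<Rightarrow> nat \<Rightarrow> bool" where
  "has_degree G d \<longleftrightarrow> (\<forall>v \<in> verts G. out_degree G v = d)"

text \<open>
  The library function \<open>wf_digraph.\<mu>\<close> is the infimum of the weights of all walks between two
  vertices; with unit weights it is the graph distance, equal to \<open>\<infinity>\<close> if there is no walk.
\<close>

definition graph_diameter :: "('a, 'b) pre_digraph \<Rightarrow> ereal" where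
  "graph_diameter G = (SUP u \<in> verts G. SUP v \<in> verts G. wf_digraph.\<mu> G (\<lambda>_. 1) u v)"

text \<open>
  By the Moore bound the set below is finite, so its supremum is its maximum whenever it is
  nonempty.  It can be empty for small \<open>d\<close>; the supremum is then \<open>0\<close>.
\<close>

definition CC :: "nat \<Rightarrow> nat \<Rightarrow> nat" where
  "CC d k = Sup {card (verts G) | n G. undirected_circulant_graph n G \<and>
                    has_degree G d \<and> graph_diameter G = ereal (real k)}"

definition LC_minus :: "nat \<Rightarrow> ereal" where
  "LC_minus k = liminf (\<lambda>d. ereal (real (CC d k) / real d ^ k))"

definition LC_plus :: "nat \<Rightarrow> ereal" where
  "LC_plus k = limsup (\<lambda>d. ereal (real (CC d k) / real d ^ k))"

text \<open>
  The limits above are finite for \<open>k > 0\<close>.  Since \<^const>\<open>real_of_ereal\<close> sends \<open>\<infinity>\<close> to \<open>0\<close>, a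
  positive lower bound on the quantities below entails that finiteness.
\<close>

definition RC_minus :: "nat \<Rightarrow> real" where
  "RC_minus k = real k * root k (real_of_ereal (LC_minus k))"

definition RC_plus :: "nat \<Rightarrow> real" where
  "RC_plus k = real k * root k (real_of_ereal (LC_plus k))"

end

theory Submission
  imports Defs "HOL-Number_Theory.Cong"
begin

text \<open>
  Suppose that every residue modulo \<open>h\<close> is a sum of \<open>k\<close> of the numbers \<open>\<plusminus>a\<^sub>0, \<dots>, \<plusminus>a\<^sub>m\<^sub>-\<^sub>1\<close> with
  distinct indices.  Let \<open>n = h r\<^sup>k\<close> and take as connection set the residues of
  \<open>\<plusminus>(a\<^sub>l + h x w\<^sub>l)\<close> with \<open>\<bar>x\<bar> \<le> r / 2 + O(1)\<close>, so that the degree is about \<open>2 m r\<close> and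
  \<open>n\<close> is about \<open>h (d / 2 m)\<^sup>k\<close>.  The diameter is at most \<open>k\<close> if, for every set \<open>J\<close> of \<open>k\<close> indices,
  every residue modulo \<open>r\<^sup>k\<close> has the form \<open>\<Sum>\<^sub>J x\<^sub>l w\<^sub>l\<close> with such short coefficients.

  This holds for \<open>w\<^sub>l = 1 / (r - d\<^sub>l)\<close> modulo \<open>r\<^sup>k\<close>, where the \<open>d\<^sub>l\<close> are suitable fixed distinct
  integers: the partial fraction decomposition of \<open>x\<^sup>k / \<Prod>\<^sub>J (x - d\<^sub>l)\<close> at \<open>x = r\<close> expresses \<open>1\<close>
  as a combination of the \<open>w\<^sub>l\<close> with bounded coefficients, hence so is
  \<open>r w\<^sub>l = 1 + d\<^sub>l w\<^sub>l\<close>.  The relation lattice of the \<open>w\<^sub>l\<close> thus contains \<open>k\<close> vectors within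
  \<open>O(1)\<close> of \<open>r\<close> times the unit vectors, and coefficients can be reduced modulo it.

  The connection set is padded to an arbitrary degree by pairs \<open>\<plusminus>s\<close> and, for odd degree, by \<open>n / 2\<close>.
  The latter requires \<open>h\<close> to be even, which is why \<open>h = 57\<close> only bounds the limes superior.
  The Moore bound \<open>n \<le> (d + 1)\<^sup>k\<close> excludes smaller diameters.
\<close>

section \<open>Short representations modulo a power\<close>

text \<open>Numerator and denominator have the same degree \<open>card J\<close>, so the polynomial
  part is 1 and each simple pole contributes its residue. A further pole p multiplies the quotient
  by x / (x - d p), and products of two poles are split again.\<close>

lemma power_div_prod_eq_partial_fractions:
  fixes d :: "'i \<Rightarrow> 'a::field"
  assumes "finite J" "inj_on d J" "x \<notin> d ` J"
  shows "x ^ card J / (\<Prod>l\<in>J. x - d l) =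
    1 + (\<Sum>l\<in>J. d l ^ card J / (\<Prod>i\<in>J - {l}. d l - d i) / (x - d l))"
  using assms
proof (induction J arbitrary: x rule: finite_induct)
  case empty
  then show ?case by simp
next
  case (insert p J)
  define c where "c l = d l ^ card J / (\<Prod>i\<in>J - {l}. d l - d i)" for l
  have IH: "y ^ card J / (\<Prod>l\<in>J. y - d l) = 1 + (\<Sum>l\<in>J. c l / (y - d l))" if "y \<notin> d ` J" for y
    using insert.IH[of y] insert.prems that by (simp add: c_def)
  have xl: "x - d l \<noteq> 0" if "l \<in> J" for l
    using insert.prems that by auto
  have xp: "x - d p \<noteq> 0"
    using insert.prems by auto
  have pl: "d p - d l \<noteq> 0" if "l \<in> J" for l
    using insert.prems insert.hyps that by (auto simp: inj_on_def)
  have coeff: "d l ^ card (insert p J) / (\<Prod>i\<in>insert p J - {l}. d l - d i) = c l * d l / (d l - d p)"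
    if "l \<in> J" for l
  proof -
    have "insert p J - {l} = insert p (J - {l})" "p \<notin> J - {l}"
      using that insert.hyps by auto
    then show ?thesis
      using insert.hyps by (simp add: c_def mult.commute)
  qed
  \<comment> \<open>The new residue is \<open>d p\<close> times the old quotient evaluated at
    \<open>d p\<close>; this is why the induction keeps \<open>x\<close> arbitrary.\<close>
  have coeff_p: "d p ^ card (insert p J) / (\<Prod>i\<in>insert p J - {p}. d p - d i) =
      d p * (1 + (\<Sum>l\<in>J. c l / (d p - d l)))"
  proof -
    have "insert p J - {p} = J" using insert.hyps by auto
    moreover have "d p \<notin> d ` J" using pl by auto
    ultimately show ?thesis
      using insert.hyps IH[of "d p"] by (simp add: mult.assoc flip: times_divide_eq_right)
  qed
  have "x ^ card (insert p J) / (\<Prod>l\<in>insert p J. x - d l) =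
      x / (x - d p) * (x ^ card J / (\<Prod>l\<in>J. x - d l))"
    using insert.hyps by simp
  also have "\<dots> = x / (x - d p) * (1 + (\<Sum>l\<in>J. c l / (x - d l)))"
    using IH insert.prems by auto
  also have "\<dots> = x / (x - d p) + (\<Sum>l\<in>J. x / (x - d p) * (c l / (x - d l)))"
    by (simp add: distrib_left sum_distrib_left)
  also have "x / (x - d p) = 1 + d p / (x - d p)"
    using xp by (simp add: field_simps)
  \<comment> \<open>Each product of two poles splits: the part at \<open>d p\<close> goes into the
    new residue, the part at \<open>d l\<close> updates the old one.\<close>
  also have "(\<Sum>l\<in>J. (1 + d p / (x - d p)) * (c l / (x - d l))) =
     (\<Sum>l\<in>J. d p * (c l / (d p - d l)) / (x - d p) + c l * d l / (d l - d p) / (x - d l))"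
  proof (rule sum.cong[OF refl])
    fix l assume l: "l \<in> J"
    have "d l - d p \<noteq> 0" using pl[OF l] by auto
    have "d p / (d p - d l) / (x - d p) + d l / (d l - d p) / (x - d l) =
        (1 + d p / (x - d p)) / (x - d l)"
    proof -
      have "d p / (d p - d l) / (x - d p) + d l / (d l - d p) / (x - d l) =
        (d p / (x - d p) - d l / (x - d l)) / (d p - d l)"
        using pl[OF l] \<open>d l - d p \<noteq> 0\<close>
        by (metis (no_types, opaque_lifting) diff_divide_distrib divide_divide_eq_left minus_diff_eq
              minus_divide_right mult.commute uminus_add_conv_diff add.commute)
      also have "d p / (x - d p) - d l / (x - d l) = (d p - d l) * x / ((x - d p) * (x - d l))"
        using xp xl[OF l] by (simp add: field_simps)
      also have "(d p - d l) * x / ((x - d p) * (x - d l)) / (d p - d l) = x / (x - d p) / (x - d l)"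
        using pl[OF l] by simp
      also have "x / (x - d p) = 1 + d p / (x - d p)"
        using xp by (simp add: field_simps)
      finally show ?thesis .
    qed
    then have "c l * ((1 + d p / (x - d p)) / (x - d l)) =
        c l * (d p / (d p - d l) / (x - d p) + d l / (d l - d p) / (x - d l))" by simp
    then show "(1 + d p / (x - d p)) * (c l / (x - d l)) =
        d p * (c l / (d p - d l)) / (x - d p) + c l * d l / (d l - d p) / (x - d l)"
      by (simp add: distrib_left add_divide_distrib mult_ac)
  qed
  also have "1 + d p / (x - d p) + \<dots> =
      1 + (d p * (1 + (\<Sum>l\<in>J. c l / (d p - d l))) / (x - d p) +
        (\<Sum>l\<in>J. c l * d l / (d l - d p) / (x - d l)))"
    by (simp add: sum.distrib distrib_left add_divide_distrib sum_distrib_left sum_divide_distrib)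
  also have "\<dots> = 1 + (\<Sum>l\<in>insert p J. d l ^ card (insert p J) /
      (\<Prod>i\<in>insert p J - {l}. d l - d i) / (x - d l))"
    unfolding sum.insert[OF insert.hyps] coeff_p by (simp add: coeff)
  finally show ?case .
qed

text \<open>With poles N (l + 1), every difference is N (l - i), and after cancellation one factor N
  remains in each residue. It absorbs the product of the l - i, so the residues are integers,
  bounded independently of r. The identity is the expansion cleared of denominators.\<close>

lemma integral_partial_fractions:
  fixes N :: int
  assumes N: "\<And>l. l < m \<Longrightarrow> (\<Prod>i\<in>{..<m} - {l}. int l - int i) dvd N"
    and N0: "N \<noteq> 0" and J: "J \<subseteq> {..<m}"
  obtains c :: "nat \<Rightarrow> int" where
    "\<And>r. (\<And>l. l \<in> J \<Longrightarrow> r \<noteq> N * (int l + 1)) \<Longrightarrow>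
      (\<Prod>l\<in>J. r - N * (int l + 1)) + (\<Sum>l\<in>J. c l * (\<Prod>i\<in>J - {l}. r - N * (int i + 1))) =
      r ^ card J"
    "\<And>l. l \<in> J \<Longrightarrow> \<bar>c l\<bar> \<le> \<bar>N\<bar> * int m ^ card J"
proof -
  define D where "D l = (\<Prod>i\<in>J - {l}. int l - int i)" for l
  define c where "c l = N div D l * (int l + 1) ^ card J" for l
  have fin: "finite J" using J finite_subset by blast
  have D_dvd: "D l dvd N" if "l \<in> J" for l
    using that J unfolding D_def
    by (intro dvd_trans[OF prod_dvd_prod_subset N[of l]]) auto
  have D_nz: "D l \<noteq> 0" for l unfolding D_def using fin by auto
  show ?thesis
  proof (rule that[of c])
    fix l assume l: "l \<in> J"
    have "\<bar>N div D l\<bar> \<le> \<bar>N\<bar>" using D_dvd[OF l] N0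
      by (metis dvd_div_mult_self dvd_imp_le_int dvd_triv_left)
    moreover have "(int l + 1) ^ card J \<le> int m ^ card J"
      using J l by (intro power_mono) auto
    ultimately show "\<bar>c l\<bar> \<le> \<bar>N\<bar> * int m ^ card J"
      by (simp add: c_def abs_mult mult_mono)
  next
    fix r :: int assume r: "\<And>l. l \<in> J \<Longrightarrow> r \<noteq> N * (int l + 1)"
    define d :: "nat \<Rightarrow> rat" where "d l = of_int (N * (int l + 1))" for l
    define x :: rat where "x = of_int r"
    have nz: "x - d l \<noteq> 0" if "l \<in> J" for l using r[OF that] by (simp add: x_def d_def del: of_int_mult)
    have inj: "inj_on d J" using N0 by (auto simp: inj_on_def d_def)
    have c: "d l ^ card J / (\<Prod>i\<in>J - {l}. d l - d i) = of_int (c l)" if l: "l \<in> J" for l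
    proof -
      have "(\<Prod>i\<in>J - {l}. d l - d i) = (\<Prod>i\<in>J - {l}. of_int N * of_int (int l - int i))"
        by (simp add: d_def algebra_simps)
      also have "\<dots> = of_int N ^ (card J - 1) * of_int (D l)"
        using l fin by (simp add: prod.distrib D_def)
      finally have "(\<Prod>i\<in>J - {l}. d l - d i) = of_int N ^ (card J - 1) * of_int (D l)" .
      moreover have "d l ^ card J = of_int N ^ (card J - 1) * (of_int N * of_int (int l + 1) ^ card J)"
      proof -
        have "card J = Suc (card J - 1)" using l fin card_gt_0_iff[of J] by auto
        then have "of_int N ^ card J = of_int N ^ (card J - 1) * (of_int N :: rat)"
          by (metis power_Suc2)
        then show ?thesis by (simp add: d_def power_mult_distrib)
      qed
      moreover have "of_int N / of_int (D l) = (of_int (N div D l) :: rat)"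
        using D_dvd[OF l] by (simp add: of_int_div)
      ultimately show ?thesis using N0 D_nz[of l]
        by (simp add: c_def field_simps)
    qed
    have "x ^ card J / (\<Prod>l\<in>J. x - d l) = 1 + (\<Sum>l\<in>J. of_int (c l) / (x - d l))"
      using power_div_prod_eq_partial_fractions[OF fin inj, of x] nz c by (auto cong: sum.cong)
    moreover have "(\<Prod>l\<in>J. x - d l) \<noteq> 0" using nz fin by auto
    ultimately have "x ^ card J = (\<Prod>l\<in>J. x - d l) * (1 + (\<Sum>l\<in>J. of_int (c l) / (x - d l)))"
      by (simp add: divide_eq_eq mult.commute)
    also have "\<dots> = (\<Prod>l\<in>J. x - d l) + (\<Sum>l\<in>J. of_int (c l) * (\<Prod>i\<in>J - {l}. x - d i))"
      using nz fin by (auto simp: distrib_left sum_distrib_left prod.remove intro!: sum.cong)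
    finally have "of_int (r ^ card J) = (of_int ((\<Prod>l\<in>J. r - N * (int l + 1)) +
        (\<Sum>l\<in>J. c l * (\<Prod>i\<in>J - {l}. r - N * (int i + 1)))) :: rat)"
      by (simp add: x_def d_def)
    then show "(\<Prod>l\<in>J. r - N * (int l + 1)) +
        (\<Sum>l\<in>J. c l * (\<Prod>i\<in>J - {l}. r - N * (int i + 1))) = r ^ card J"
      unfolding of_int_eq_iff by (rule sym)
  qed
qed

text \<open>
  Applied to a coset of a lattice that contains \<open>r\<close> times each unit vector up to an error of size
  \<open>E\<close>: an element of minimal maximum norm cannot be improved by rounding its coordinates to
  multiples of \<open>r\<close>.
\<close>

lemma small_coset_representative:
  fixes r :: int
  assumes r: "r > 0" "2 * E \<le> r" and E: "E \<ge> 0"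
    and nonempty: "P x0" and J: "finite J"
    and reduce: "\<And>x z \<zeta>. \<lbrakk>P x; \<And>l. l \<in> J \<Longrightarrow> \<bar>z l\<bar> \<le> \<zeta>\<rbrakk> \<Longrightarrow>
      \<exists>y. P y \<and> (\<forall>l\<in>J. \<bar>y l - (x l - r * z l)\<bar> \<le> E * \<zeta>)"
  shows "\<exists>x::'i \<Rightarrow> int. P x \<and> (\<forall>l\<in>J. 2 * \<bar>x l\<bar> \<le> r + 4 * E)"
proof -
  define Q where "Q b \<longleftrightarrow> (\<exists>x. P x \<and> (\<forall>l\<in>J. \<bar>x l\<bar> \<le> int b))" for b
  have "Q (nat (\<Sum>l\<in>J. \<bar>x0 l\<bar>))"
    unfolding Q_def using nonempty J
    by (intro exI[of _ x0]) (auto simp: sum_nonneg intro!: member_le_sum)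
  then have QL: "Q (Least Q)" by (rule LeastI)
  define b where "b = int (Least Q)"
  obtain x where x: "P x" "\<And>l. l \<in> J \<Longrightarrow> \<bar>x l\<bar> \<le> b"
    using QL by (auto simp: Q_def b_def)
  have "2 * b \<le> r + 4 * E"
  proof (rule ccontr)
    assume b: "\<not> 2 * b \<le> r + 4 * E"
    \<comment> \<open>\<open>z l\<close> is the integer nearest to x l / r, and \<zeta> is the same
      rounding of b / r, so it bounds every |z l|.\<close>
    define \<zeta> where "\<zeta> = (2 * b + r) div (2 * r)"
    define z where "z l = (2 * x l + r) div (2 * r)" for l
    have div_bounds: "2 * r * (a div (2 * r)) \<le> a" "a < 2 * r * (a div (2 * r)) + 2 * r" for a
      using mult_div_mod_eq[of "2 * r" a] pos_mod_sign[of "2 * r" a] pos_mod_bound[of "2 * r" a] r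
      by linarith+
    have z1: "2 * \<bar>x l - r * z l\<bar> \<le> r" for l
      using div_bounds[of "2 * x l + r"] unfolding z_def by (simp add: abs_if)
    have z2: "\<bar>z l\<bar> \<le> \<zeta>" if "l \<in> J" for l
    proof -
      have "2 * r * \<bar>z l\<bar> = 2 * \<bar>r * z l\<bar>" using r by (simp add: abs_mult)
      also have "\<dots> \<le> 2 * b + r" using z1[of l] x(2)[OF that] abs_triangle_ineq2[of "r * z l" "x l"]
        by (simp add: abs_minus_commute)
      finally have "2 * r * \<bar>z l\<bar> \<le> 2 * b + r" .
      then have "2 * r * \<bar>z l\<bar> div (2 * r) \<le> \<zeta>"
        unfolding \<zeta>_def using r by (intro zdiv_mono1) auto
      then show ?thesis using r by simp
    qed
    obtain y where y: "P y" "\<forall>l\<in>J. \<bar>y l - (x l - r * z l)\<bar> \<le> E * \<zeta>"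
      using reduce[OF x(1), of z \<zeta>] z2 by auto
    have "2 * r * \<zeta> \<le> 2 * b + r"
      unfolding \<zeta>_def by (rule div_bounds)
    \<comment> \<open>The reduced element has norm at most r/2 + E \<zeta>. For \<zeta> at most 2
      this is below b by the assumption on b, whence the constant 4 E; for larger \<zeta> it follows
      from 2 E \<le> r and b \<ge> r \<zeta> - r/2.\<close>
    have less: "r + 2 * (E * \<zeta>) < 2 * b"
    proof (cases "\<zeta> \<le> 2")
      case True
      then have "E * \<zeta> \<le> E * 2" using E by (rule mult_left_mono)
      then show ?thesis using b by linarith
    next
      case False
      then have "2 * E * \<zeta> \<le> r * \<zeta>" "r * 3 \<le> r * \<zeta>"
        using r by (auto intro: mult_right_mono)
      then show ?thesis using \<open>2 * r * \<zeta> \<le> 2 * b + r\<close> r by linarith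
    qed
    have "\<bar>a\<bar> < b" if "\<bar>a - v\<bar> \<le> e" "2 * \<bar>v\<bar> \<le> r" "r + 2 * e < 2 * b" for a v e
      using that by linarith
    then have "\<bar>y l\<bar> < b" if "l \<in> J" for l
      using y(2) z1 less that by blast
    moreover have "b > 0" using less b r E by linarith
    ultimately have "Q (nat (b - 1))"
      unfolding Q_def using y(1) by (intro exI[of _ y]) auto
    then have "Least Q \<le> nat (b - 1)" by (rule Least_le)
    then show False using \<open>b > 0\<close> by (auto simp: b_def)
  qed
  then show ?thesis using x by fastforce
qed

text \<open>Multiplied by the product of the \<open>w l\<close>, the integral partial fraction
  identity loses all factors (r - d l) w l, which are 1, while its right side vanishes modulo r^k.
  What remains is the relation with coefficients bounded independently of r.\<close>

lemma ex_bounded_relations: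
  fixes k m :: nat
  obtains N E :: nat where "N > 0"
    "\<And>r. \<lbrakk>[r = 1] (mod N); E < r\<rbrakk> \<Longrightarrow> \<exists>d w :: nat \<Rightarrow> int.
       (\<forall>l<m. \<bar>d l\<bar> \<le> int E \<and> [(int r - d l) * w l = 1] (mod int r ^ k)) \<and>
       (\<forall>J. J \<subseteq> {..<m} \<and> card J = k \<longrightarrow>
         (\<exists>c. (\<forall>l\<in>J. \<bar>c l\<bar> \<le> int E) \<and> [1 + (\<Sum>l\<in>J. c l * w l) = 0] (mod int r ^ k)))"
proof -
  define N where "N = (\<Prod>l<m. \<Prod>i\<in>{..<m} - {l}. int l - int i)"
  have N: "(\<Prod>i\<in>{..<m} - {l}. int l - int i) dvd N" if "l < m" for l
    unfolding N_def using that by (intro dvd_prodI) auto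
  have N0: "N \<noteq> 0" by (auto simp: N_def)
  \<comment> \<open>The summands bound \<open>d l\<close> and \<open>c l\<close>; in addition, r > E
    keeps r away from the poles \<open>d l\<close>.\<close>
  define E where "E = nat (\<bar>N\<bar> * int m + \<bar>N\<bar> * int m ^ k)"
  show ?thesis
  \<comment> \<open>This modulus is a multiple of every \<open>d l\<close>, so r = 1 modulo it makes
    r coprime to \<open>d l\<close>, and r - d l invertible modulo r^k.\<close>
  proof (rule that[of "nat \<bar>N\<bar> * fact m" E])
    show "nat \<bar>N\<bar> * fact m > 0" using N0 by simp
    fix r assume r: "[r = 1] (mod nat \<bar>N\<bar> * fact m)" and rE: "E < r"
    define d where "d l = N * (int l + 1)" for l
    have d_le: "\<bar>d l\<bar> \<le> int E" if "l < m" for l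
    proof -
      have "\<bar>d l\<bar> \<le> \<bar>N\<bar> * int m"
        unfolding d_def abs_mult using that by (intro mult_left_mono) auto
      then show ?thesis by (simp add: E_def add_increasing2)
    qed
    have "coprime r (nat \<bar>N\<bar> * fact m)" using r
      by (metis cong_imp_coprime cong_sym coprime_1_left)
    then have "coprime (int r) (int (nat \<bar>N\<bar> * fact m))"
      by (simp only: coprime_int_iff)
    then have cop: "coprime (int r) (\<bar>N\<bar> * fact m)" by simp
    have "\<exists>w. [(int r - d l) * w = 1] (mod int r ^ k)" if "l < m" for l
    proof (rule cong_solve_coprime_int)
      have "Suc l dvd fact m" using that by (intro dvd_fact) auto
      then have "int (Suc l) dvd fact m" by (metis of_nat_dvd_iff of_nat_fact)
      then have "d l dvd \<bar>N\<bar> * fact m" unfolding d_def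
        by (intro mult_dvd_mono) (auto simp: add.commute)
      then have "coprime (int r) (d l)" by (rule coprime_divisors[OF dvd_refl _ cop])
      moreover have "[- d l = int r - d l] (mod int r)" by (simp add: cong_iff_dvd_diff)
      ultimately have "coprime (int r - d l) (int r)"
        using cong_imp_coprime[of "- d l" "int r - d l" "int r"] by (simp add: coprime_commute)
      then show "coprime (int r - d l) (int r ^ k)" by simp
    qed
    then obtain w where w: "\<And>l. l < m \<Longrightarrow> [(int r - d l) * w l = 1] (mod int r ^ k)"
      by metis
    have "\<exists>c. (\<forall>l\<in>J. \<bar>c l\<bar> \<le> int E) \<and> [1 + (\<Sum>l\<in>J. c l * w l) = 0] (mod int r ^ k)"
      if J: "J \<subseteq> {..<m}" and k: "card J = k" for J
    proof -
      have fin: "finite J" using J finite_subset by blast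
      obtain c where c: "\<And>r. (\<And>l. l \<in> J \<Longrightarrow> r \<noteq> N * (int l + 1)) \<Longrightarrow>
          (\<Prod>l\<in>J. r - N * (int l + 1)) + (\<Sum>l\<in>J. c l * (\<Prod>i\<in>J - {l}. r - N * (int i + 1))) =
          r ^ card J"
        "\<And>l. l \<in> J \<Longrightarrow> \<bar>c l\<bar> \<le> \<bar>N\<bar> * int m ^ card J"
        using integral_partial_fractions[OF N N0 J] by blast
      have "int r \<noteq> d l" if "l \<in> J" for l
        using that J d_le[of l] rE by auto
      then have eq: "(\<Prod>l\<in>J. int r - d l) + (\<Sum>l\<in>J. c l * (\<Prod>i\<in>J - {l}. int r - d i)) = int r ^ k"
        using c(1)[of "int r"] k by (simp add: d_def)
      have one: "[(\<Prod>i\<in>I. (int r - d i) * w i) = 1] (mod int r ^ k)" if "I \<subseteq> J" for I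
      proof -
        have "[(\<Prod>i\<in>I. (int r - d i) * w i) = (\<Prod>i\<in>I. 1)] (mod int r ^ k)"
          using that J by (intro cong_prod w) auto
        then show ?thesis by simp
      qed
      have "[(\<Prod>l\<in>J. (int r - d l) * w l) +
          (\<Sum>l\<in>J. c l * (w l * (\<Prod>i\<in>J - {l}. (int r - d i) * w i))) =
          1 + (\<Sum>l\<in>J. c l * (w l * 1))] (mod int r ^ k)"
        by (intro cong_add cong_sum cong_mult cong_refl one) auto
      moreover have "(\<Prod>l\<in>J. (int r - d l) * w l) +
          (\<Sum>l\<in>J. c l * (w l * (\<Prod>i\<in>J - {l}. (int r - d i) * w i))) =
          (\<Prod>l\<in>J. w l) * int r ^ k"
        unfolding eq[symmetric] distrib_left sum_distrib_left
        using fin by (auto simp: prod.distrib prod.remove mult_ac intro!: sum.cong arg_cong2[where f = "(+)"])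
      ultimately have "[1 + (\<Sum>l\<in>J. c l * w l) = 0] (mod int r ^ k)"
        by (metis (no_types, lifting) cong_mult_self_right cong_sym cong_trans mult.right_neutral sum.cong)
      moreover have "\<forall>l\<in>J. \<bar>c l\<bar> \<le> int E"
      proof
        fix l assume "l \<in> J"
        then have "\<bar>c l\<bar> \<le> \<bar>N\<bar> * int m ^ k" using c(2) k by auto
        then show "\<bar>c l\<bar> \<le> int E" by (simp add: E_def add_increasing)
      qed
      ultimately show ?thesis by blast
    qed
    with d_le w show "\<exists>d w. (\<forall>l<m. \<bar>d l\<bar> \<le> int E \<and> [(int r - d l) * w l = 1] (mod int r ^ k)) \<and>
       (\<forall>J. J \<subseteq> {..<m} \<and> card J = k \<longrightarrow>
         (\<exists>c. (\<forall>l\<in>J. \<bar>c l\<bar> \<le> int E) \<and> [1 + (\<Sum>l\<in>J. c l * w l) = 0] (mod int r ^ k)))"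
      by blast
  qed
qed

text \<open>From (r - d l) w l = 1 and 1 + sum of c j w j = 0, the relation lattice contains (r - d
  l) times the l-th unit vector plus c, which is within O(1) of r times that vector. Any solution of
  the congruence can therefore be reduced to entries of size r/2 + O(1).\<close>

lemma ex_directions:
  fixes k m :: nat
  assumes "k > 0"
  obtains N C :: nat where "N > 0"
    "\<And>r. \<lbrakk>[r = 1] (mod N); C < r\<rbrakk> \<Longrightarrow> \<exists>w :: nat \<Rightarrow> int.
       \<forall>J u. J \<subseteq> {..<m} \<and> card J = k \<longrightarrow>
         (\<exists>x. (\<forall>l\<in>J. 2 * \<bar>x l\<bar> \<le> int (r + C)) \<and>
              [(\<Sum>l\<in>J. x l * w l) = u] (mod int r ^ k))"
proof -
  obtain N E where N: "N > 0" and ex: "\<And>r. \<lbrakk>[r = 1] (mod N); E < r\<rbrakk> \<Longrightarrow> \<exists>d w :: nat \<Rightarrow> int.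
       (\<forall>l<m. \<bar>d l\<bar> \<le> int E \<and> [(int r - d l) * w l = 1] (mod int r ^ k)) \<and>
       (\<forall>J. J \<subseteq> {..<m} \<and> card J = k \<longrightarrow>
         (\<exists>c. (\<forall>l\<in>J. \<bar>c l\<bar> \<le> int E) \<and> [1 + (\<Sum>l\<in>J. c l * w l) = 0] (mod int r ^ k)))"
    by (rule ex_bounded_relations[where m = m and k = k]) (rule that)
  \<comment> \<open>\<open>E\<close> covers the shift by d l z l, and \<open>E * k\<close> the shift
    by c l times the sum of the k numbers z j.\<close>
  define F where "F = E + E * k"
  show ?thesis
  proof (rule that[of N "4 * F"])
    show "N > 0" by fact
    fix r assume r: "[r = 1] (mod N)" "4 * F < r"
    then have "E < r" by (auto simp: F_def)
    from ex[OF r(1) this] obtain d w where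
      d: "\<And>l. l < m \<Longrightarrow> \<bar>d l\<bar> \<le> int E" and
      w: "\<And>l. l < m \<Longrightarrow> [(int r - d l) * w l = 1] (mod int r ^ k)" and
      c: "\<And>J. J \<subseteq> {..<m} \<Longrightarrow> card J = k \<Longrightarrow>
         \<exists>c. (\<forall>l\<in>J. \<bar>c l\<bar> \<le> int E) \<and> [1 + (\<Sum>l\<in>J. c l * w l) = 0] (mod int r ^ k)"
      by blast
    have "\<exists>x. (\<forall>l\<in>J. 2 * \<bar>x l\<bar> \<le> int (r + 4 * F)) \<and> [(\<Sum>l\<in>J. x l * w l) = u] (mod int r ^ k)"
      if J: "J \<subseteq> {..<m}" and k: "card J = k" for J u
    proof -
      have fin: "finite J" using J finite_subset by blast
      obtain c where c_le: "\<And>l. l \<in> J \<Longrightarrow> \<bar>c l\<bar> \<le> int E"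
        and c0: "[1 + (\<Sum>l\<in>J. c l * w l) = 0] (mod int r ^ k)"
        using c[OF J k] by blast
      define P where "P x \<longleftrightarrow> [(\<Sum>l\<in>J. x l * w l) = u] (mod int r ^ k)" for x
      obtain l0 where l0: "l0 \<in> J" using k assms by (metis all_not_in_conv card.empty less_irrefl)
      \<comment> \<open>As \<open>w l0\<close> is invertible, a single coordinate provides a first
        solution.\<close>
      have "P (\<lambda>l. if l = l0 then u * (int r - d l0) else 0)"
      proof -
        have "(\<Sum>l\<in>J. (if l = l0 then u * (int r - d l0) else 0) * w l) = u * ((int r - d l0) * w l0)"
          using fin l0 by (simp add: if_distrib[of "\<lambda>x. x * _"] mult.assoc cong: if_cong)
        moreover have "[u * ((int r - d l0) * w l0) = u * 1] (mod int r ^ k)"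
          using w[of l0] l0 J by (intro cong_mult cong_refl) auto
        ultimately show ?thesis by (simp add: P_def)
      qed
      moreover have "\<exists>y. P y \<and> (\<forall>l\<in>J. \<bar>y l - (x l - int r * z l)\<bar> \<le> int F * \<zeta>)"
        if x: "P x" and z: "\<And>l. l \<in> J \<Longrightarrow> \<bar>z l\<bar> \<le> \<zeta>" for x z \<zeta>
      proof -
        define Z where "Z = (\<Sum>j\<in>J. z j)"
        \<comment> \<open>The relation vectors are subtracted with weights \<open>z l\<close>; their
          common part c receives the total weight \<open>Z\<close>.\<close>
        define y where "y l = x l - int r * z l + (d l * z l - c l * Z)" for l
        have "[(\<Sum>l\<in>J. z l * ((int r - d l) * w l)) = (\<Sum>l\<in>J. z l * 1)] (mod int r ^ k)"
          using J by (intro cong_sum cong_mult cong_refl w) auto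
        then have "[((\<Sum>l\<in>J. x l * w l) - (\<Sum>l\<in>J. z l * ((int r - d l) * w l)) + Z) - Z * (1 + (\<Sum>l\<in>J. c l * w l)) =
            ((\<Sum>l\<in>J. x l * w l) - (\<Sum>l\<in>J. z l * 1) + Z) - Z * 0] (mod int r ^ k)"
          by (intro cong_diff cong_add cong_mult cong_refl c0)
        moreover have "(\<Sum>l\<in>J. y l * w l) =
            ((\<Sum>l\<in>J. x l * w l) - (\<Sum>l\<in>J. z l * ((int r - d l) * w l)) + Z) - Z * (1 + (\<Sum>l\<in>J. c l * w l))"
          unfolding y_def by (simp add: algebra_simps sum.distrib sum_subtractf sum_distrib_left)
        ultimately have "[(\<Sum>l\<in>J. y l * w l) = (\<Sum>l\<in>J. x l * w l)] (mod int r ^ k)"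
          by (simp add: Z_def)
        then have "P y" using x unfolding P_def by (rule cong_trans)
        moreover have "\<bar>y l - (x l - int r * z l)\<bar> \<le> int F * \<zeta>" if l: "l \<in> J" for l
        proof -
          have "\<bar>Z\<bar> \<le> (\<Sum>j\<in>J. \<bar>z j\<bar>)" unfolding Z_def by (rule sum_abs)
          also have "\<dots> \<le> int k * \<zeta>" using sum_bounded_above[of J "\<lambda>j. \<bar>z j\<bar>" \<zeta>] z k by simp
          finally have "\<bar>c l\<bar> * \<bar>Z\<bar> \<le> int E * (int k * \<zeta>)"
            using c_le[OF l] by (intro mult_mono) auto
          moreover have "\<bar>d l\<bar> * \<bar>z l\<bar> \<le> int E * \<zeta>"
            using d[of l] l J z[OF l] by (intro mult_mono) auto
          moreover have "\<bar>y l - (x l - int r * z l)\<bar> \<le> \<bar>d l\<bar> * \<bar>z l\<bar> + \<bar>c l\<bar> * \<bar>Z\<bar>"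
            unfolding y_def using abs_triangle_ineq4[of "d l * z l" "c l * Z"]
            by (simp add: abs_mult)
          ultimately show ?thesis by (simp add: F_def algebra_simps)
        qed
        ultimately show ?thesis by blast
      qed
      ultimately have "\<exists>x. P x \<and> (\<forall>l\<in>J. 2 * \<bar>x l\<bar> \<le> int r + 4 * int F)"
        using r(2) by (intro small_coset_representative[OF _ _ _ _ fin]) auto
      then show ?thesis by (auto simp: P_def)
    qed
    then show "\<exists>w. \<forall>J u. J \<subseteq> {..<m} \<and> card J = k \<longrightarrow>
         (\<exists>x. (\<forall>l\<in>J. 2 * \<bar>x l\<bar> \<le> int (r + 4 * F)) \<and>
              [(\<Sum>l\<in>J. x l * w l) = u] (mod int r ^ k))"
      by blast
  qed
qed

section \<open>Circulant graphs\<close>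

abbreviation circulant :: "nat \<Rightarrow> int set \<Rightarrow> (int, int \<times> int) pre_digraph" where
  "circulant n S \<equiv> cayley_graph (integer_mod_group n) S"

lemma verts_circulant: "n > 0 \<Longrightarrow> verts (circulant n S) = {0..<int n}"
  by (simp add: cayley_graph_def carrier_integer_mod_group)

lemma arcs_circulant:
  "n > 0 \<Longrightarrow> arcs (circulant n S) = {(g, (g + s) mod int n) | g s. g \<in> {0..<int n} \<and> s \<in> S}"
  by (simp add: cayley_graph_def carrier_integer_mod_group)

lemma tail_circulant [simp]: "tail (circulant n S) = fst"
  and head_circulant [simp]: "head (circulant n S) = snd"
  by (simp_all add: cayley_graph_def)

lemma wf_circulant: "n > 0 \<Longrightarrow> wf_digraph (circulant n S)"
  by unfold_locales (auto simp: verts_circulant arcs_circulant)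

lemma out_degree_circulant:
  assumes "S \<subseteq> {0..<int n}" "v \<in> {0..<int n}"
  shows "out_degree (circulant n S) v = card S"
proof -
  have n: "n > 0" using assms by (cases n) auto
  have "out_arcs (circulant n S) v = (\<lambda>s. (v, (v + s) mod int n)) ` S"
    using assms n by (auto simp: out_arcs_def arcs_circulant)
  moreover have "inj_on (\<lambda>s. (v, (v + s) mod int n)) S"
  proof (rule inj_onI)
    fix s t assume st: "s \<in> S" "t \<in> S" "(v, (v + s) mod int n) = (v, (v + t) mod int n)"
    then have "[v + s = v + t] (mod int n)" by (simp add: cong_def)
    then have "[s = t] (mod int n)" by (simp add: cong_add_lcancel)
    then show "s = t" using st assms(1) by (auto simp: cong_def subset_iff)
  qed
  ultimately show ?thesis by (simp add: out_degree_def card_image)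
qed

section \<open>Walks and diameters of circulant graphs\<close>

lemma awalk_circulant_endpoint:
  assumes "n > 0" "pre_digraph.awalk (circulant n S) u p v"
  shows "\<exists>gs. length gs = length p \<and> set gs \<subseteq> S \<and> v = (u + sum_list gs) mod int n"
  using assms(2)
proof (induction p arbitrary: u)
  case Nil
  then show ?case
    using assms(1) by (auto simp: pre_digraph.awalk_def pre_digraph.cas.simps verts_circulant)
next
  case (Cons e p)
  from Cons.prems obtain s where s: "s \<in> S" "e = (u, (u + s) mod int n)"
    using assms(1) by (auto simp: pre_digraph.awalk_def pre_digraph.cas.simps arcs_circulant)
  have "pre_digraph.awalk (circulant n S) ((u + s) mod int n) p v"
    using Cons.prems s assms(1) by (auto simp: pre_digraph.awalk_def pre_digraph.cas.simps verts_circulant)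
  from Cons.IH[OF this] obtain gs where "length gs = length p" "set gs \<subseteq> S"
    "v = ((u + s) mod int n + sum_list gs) mod int n" by blast
  then show ?case
    using s(1) by (intro exI[of _ "s # gs"]) (simp add: mod_add_left_eq add.assoc)
qed

lemma ex_awalk_circulant:
  assumes "n > 0" "u \<in> {0..<int n}" "set gs \<subseteq> S"
  shows "\<exists>p. length p = length gs \<and>
    pre_digraph.awalk (circulant n S) u p ((u + sum_list gs) mod int n)"
  using assms(2,3)
proof (induction gs arbitrary: u)
  case Nil
  then show ?case
    using assms(1) by (auto simp: pre_digraph.awalk_def pre_digraph.cas.simps verts_circulant)
next
  case (Cons g gs)
  let ?u = "(u + g) mod int n"
  have "?u \<in> {0..<int n}" "set gs \<subseteq> S" using assms(1) Cons.prems by auto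
  from Cons.IH[OF this] obtain p where "length p = length gs"
    "pre_digraph.awalk (circulant n S) ?u p ((?u + sum_list gs) mod int n)" by blast
  moreover have "(?u + sum_list gs) mod int n = (u + sum_list (g # gs)) mod int n"
    by (simp add: mod_add_left_eq add.assoc)
  ultimately show ?case
    using Cons.prems assms(1) by (intro exI[of _ "(u, ?u) # p"])
      (auto simp: pre_digraph.awalk_def pre_digraph.cas.simps verts_circulant arcs_circulant)
qed

lemma (in wf_digraph) awalk_cost_unit: "awalk_cost (\<lambda>_. 1) p = real (length p)"
  by (induction p) simp_all

text \<open>Every vertex is a sum of at most k elements of S; padding with zeros to length exactly k
  leaves (card S + 1)^k lists to count.\<close>

lemma circulant_moore_bound:
  assumes n: "n > 0" and S: "finite S"
    and diam: "graph_diameter (circulant n S) < ereal (real (Suc k))"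
  shows "n \<le> (card S + 1) ^ k"
proof -
  interpret wf_digraph "circulant n S" using n by (rule wf_circulant)
  have "\<exists>gs. length gs = k \<and> set gs \<subseteq> insert 0 S \<and> v = sum_list gs mod int n"
    if v: "v \<in> {0..<int n}" for v
  proof -
    have "\<mu> (\<lambda>_. 1) 0 v \<le> graph_diameter (circulant n S)"
      unfolding graph_diameter_def using n v
      by (intro SUP_upper2[of 0] SUP_upper2[of v]) (auto simp: verts_circulant)
    \<comment> \<open>The strict bound lets the infimum over walks be replaced by an actual walk of
      length at most k.\<close>
    with diam have "\<mu> (\<lambda>_. 1) 0 v < ereal (real (Suc k))" by (rule le_less_trans[rotated])
    then obtain p where p: "awalk 0 p v" "length p < Suc k"
      unfolding \<mu>_def INF_less_iff by (auto simp: awalk_cost_unit)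
    from awalk_circulant_endpoint[OF n p(1)] obtain gs where
      gs: "length gs = length p" "set gs \<subseteq> S" "v = (0 + sum_list gs) mod int n" by blast
    show ?thesis
      using gs p(2) by (intro exI[of _ "gs @ replicate (k - length gs) 0"])
        (auto simp: sum_list_replicate)
  qed
  then have "{0..<int n} \<subseteq> (\<lambda>gs. sum_list gs mod int n) ` {gs. set gs \<subseteq> insert 0 S \<and> length gs = k}"
    by blast
  then have "card {0..<int n} \<le> card {gs. set gs \<subseteq> insert 0 S \<and> length gs = k}"
    using S by (intro surj_card_le finite_lists_length_eq) auto
  also have "\<dots> = card (insert 0 S) ^ k" using S by (intro card_lists_length_eq) auto
  also have "\<dots> \<le> (card S + 1) ^ k"
    using card_insert_le_m1 S by (intro power_mono) (auto simp: card_insert_if)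
  finally show ?thesis by simp
qed

text \<open>By translation, walks from u to v correspond to lists of connection elements with sum v
  - u.\<close>

lemma circulant_diameter_le:
  assumes n: "n > 0"
    and cover: "\<And>v. v \<in> {0..<int n} \<Longrightarrow> \<exists>gs. length gs \<le> k \<and> set gs \<subseteq> S \<and> [sum_list gs = v] (mod int n)"
  shows "graph_diameter (circulant n S) \<le> ereal (real k)"
proof -
  interpret wf_digraph "circulant n S" using n by (rule wf_circulant)
  show ?thesis
    unfolding graph_diameter_def
  proof (intro SUP_least)
    fix u v assume uv: "u \<in> verts (circulant n S)" "v \<in> verts (circulant n S)"
    have "(v - u) mod int n \<in> {0..<int n}" using n by simp
    from cover[OF this] obtain gs where gs: "length gs \<le> k" "set gs \<subseteq> S"
      "[sum_list gs = (v - u) mod int n] (mod int n)" by blast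
    have "[u + sum_list gs = u + (v - u)] (mod int n)"
      using gs(3) by (intro cong_add cong_refl) (simp add: cong_def)
    then have "(u + sum_list gs) mod int n = v"
      using uv n by (simp add: cong_def verts_circulant)
    then obtain p where "length p = length gs" "awalk u p v"
      using ex_awalk_circulant[OF n _ gs(2), of u] uv n by (auto simp: verts_circulant)
    then have "\<mu> (\<lambda>_. 1) u v \<le> ereal (real (length gs))"
      using min_cost_le_walk_cost[of u p v "\<lambda>_. 1"] by (simp add: awalk_cost_unit)
    also have "\<dots> \<le> ereal (real k)" using gs(1) by simp
    finally show "\<mu> (\<lambda>_. 1) u v \<le> ereal (real k)" .
  qed
qed

section \<open>Bounds for \<open>CC\<close> in both directions\<close>

lemma CC_set_le:
  assumes "x \<in> {card (verts G) | n G. undirected_circulant_graph n G \<and>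
                    has_degree G d \<and> graph_diameter G = ereal (real k)}"
  shows "x \<le> (d + 1) ^ k"
proof -
  obtain n S where n: "n > 0" and S: "S \<subseteq> {0..<int n}" and deg: "has_degree (circulant n S) d"
    and diam: "graph_diameter (circulant n S) = ereal (real k)" and x: "x = card (verts (circulant n S))"
    using assms by (auto simp: undirected_circulant_graph_def carrier_integer_mod_group)
  have "card S = d"
    using deg out_degree_circulant[OF S, of 0] n by (auto simp: has_degree_def verts_circulant)
  moreover have "finite S" using S finite_subset by blast
  ultimately show ?thesis
    using circulant_moore_bound[OF n, of S k] diam x n by (simp add: verts_circulant)
qed

lemma CC_le: "CC d k \<le> (d + 1) ^ k"
proof (cases "{card (verts G) | n G. undirected_circulant_graph n G \<and>
                    has_degree G d \<and> graph_diameter G = ereal (real k)} = {}")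
  \<comment> \<open>The supremum of the empty set of naturals is 0 by convention.\<close>
  case True
  then show ?thesis by (simp add: CC_def Sup_nat_def)
next
  case False
  then show ?thesis unfolding CC_def by (rule cSup_least) (rule CC_set_le)
qed

text \<open>The diameter must be exactly k: the representations give at most k, and n exceeds the
  Moore bound for k - 1.\<close>

lemma CC_ge:
  assumes n: "n > (d + 1) ^ (k - 1)" and k: "k > 0"
    and S: "S \<subseteq> {0<..<int n}" "card S = d" "\<And>s. s \<in> S \<Longrightarrow> int n - s \<in> S"
    and cover: "\<And>v. v \<in> {0..<int n} \<Longrightarrow> \<exists>gs. length gs \<le> k \<and> set gs \<subseteq> S \<and> [sum_list gs = v] (mod int n)"
  shows "n \<le> CC d k"
proof -
  have n0: "n > 0" using n by (cases n) auto
  have inv: "inv\<^bsub>integer_mod_group n\<^esub> s = int n - s" if "s \<in> S" for s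
  proof -
    have s: "0 < s" "s < int n" using that S(1) by auto
    then have "- s mod int n = int n - s" by (simp add: zmod_zminus1_eq_if)
    then show ?thesis using s n0
      by (simp add: carrier_integer_mod_group)
  qed
  have "(\<lambda>s. inv\<^bsub>integer_mod_group n\<^esub> s) ` S = S"
    using S(3) inv by (force simp: image_iff)
  then have und: "undirected_circulant_graph n (circulant n S)"
    unfolding undirected_circulant_graph_def using n0 S(1)
    by (auto simp: carrier_integer_mod_group intro!: exI[of _ S])
  have S': "S \<subseteq> {0..<int n}" using S(1) by auto
  then have "finite S" using finite_subset by blast
  have "has_degree (circulant n S) d"
    using out_degree_circulant[OF S'] S(2) n0 by (simp add: has_degree_def verts_circulant)
  moreover have "graph_diameter (circulant n S) = ereal (real k)"
  proof (rule antisym)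
    show "graph_diameter (circulant n S) \<le> ereal (real k)"
      using n0 cover by (rule circulant_diameter_le)
    show "ereal (real k) \<le> graph_diameter (circulant n S)"
    proof (rule ccontr)
      assume "\<not> ?thesis"
      then have "graph_diameter (circulant n S) < ereal (real (Suc (k - 1)))" using k by simp
      then show False
        using circulant_moore_bound[OF n0 \<open>finite S\<close>] S(2) n by fastforce
    qed
  qed
  moreover have "card (verts (circulant n S)) = n" using n0 by (simp add: verts_circulant)
  ultimately have "n \<in> {card (verts G) | n G. undirected_circulant_graph n G \<and>
                    has_degree G d \<and> graph_diameter G = ereal (real k)}"
    using und by force
  then show ?thesis unfolding CC_def
    by (rule cSup_upper) (auto intro!: bdd_aboveI[of _ "(d + 1) ^ k"] CC_set_le)
qed

section \<open>Signed sums modulo h\<close>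

text \<open>Index sets have exactly k elements because short representations are available for that
  size. The last clause keeps generators lifted from the entries distinct from their own
  negatives.\<close>

definition signed_sum_basis :: "nat \<Rightarrow> nat \<Rightarrow> int list \<Rightarrow> bool" where
  "signed_sum_basis h k as \<longleftrightarrow>
     (\<forall>t. \<exists>J e. J \<subseteq> {..<length as} \<and> card J = k \<and> (\<forall>j\<in>J. \<bar>e j\<bar> = 1) \<and>
        [(\<Sum>j\<in>J. e j * as ! j) = t] (mod int h)) \<and>
     (\<forall>a\<in>set as. \<not> int h dvd 2 * a)"

text \<open>
  Sign patterns are coded in base 3, lowest digit first: digit 2 means coefficient \<open>-1\<close>.  The bases
  below were found by computer search; entry \<open>t\<close> of a table codes a representation of \<open>t\<close>.
\<close>

fun ternary_sum :: "int list \<Rightarrow> int \<Rightarrow> int" where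
  "ternary_sum [] n = 0"
| "ternary_sum (a # as) n =
     (if n mod 3 = 0 then 0 else if n mod 3 = 1 then a else - a) + ternary_sum as (n div 3)"

fun ternary_weight :: "int list \<Rightarrow> int \<Rightarrow> nat" where
  "ternary_weight [] n = 0"
| "ternary_weight (a # as) n =
     (if n mod 3 = 0 then ternary_weight as (n div 3) else Suc (ternary_weight as (n div 3)))"

lemma ternary_sum_eq:
  "\<exists>J e. J \<subseteq> {..<length as} \<and> card J = ternary_weight as n \<and> (\<forall>j\<in>J. \<bar>e j\<bar> = 1) \<and>
     ternary_sum as n = (\<Sum>j\<in>J. e j * as ! j)"
proof (induction as arbitrary: n)
  case Nil
  then show ?case by (intro exI[of _ "{}"]) auto
next
  case (Cons a as)
  obtain J and e :: "nat \<Rightarrow> int" where J: "J \<subseteq> {..<length as}" "card J = ternary_weight as (n div 3)"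
    "\<forall>j\<in>J. \<bar>e j\<bar> = 1" "ternary_sum as (n div 3) = (\<Sum>j\<in>J. e j * as ! j)"
    using Cons.IH[of "n div 3"] by blast
  define b :: int where "b = (if n mod 3 = 1 then 1 else - 1)"
  define e' where "e' j = (if j = 0 then b else e (j - 1))" for j
  have fin: "finite J" using J(1) finite_subset by blast
  have shift: "(\<Sum>j\<in>Suc ` J. e' j * (a # as) ! j) = ternary_sum as (n div 3)"
    unfolding J(4) by (simp add: sum.reindex e'_def)
  show ?case
  proof (cases "n mod 3 = 0")
    case True
    then show ?thesis using J shift
      by (intro exI[of _ "Suc ` J"] exI[of _ e']) (auto simp: card_image e'_def)
  next
    case False
    have "(\<Sum>j\<in>insert 0 (Suc ` J). e' j * (a # as) ! j) = b * a + ternary_sum as (n div 3)"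
      using fin shift by (subst sum.insert) (auto simp: e'_def)
    also have "\<dots> = ternary_sum (a # as) n" using False by (simp add: b_def)
    finally have "(\<Sum>j\<in>insert 0 (Suc ` J). e' j * (a # as) ! j) = ternary_sum (a # as) n" .
    moreover have "card (insert 0 (Suc ` J)) = ternary_weight (a # as) n"
      using fin J(2) False by (simp add: card_image)
    ultimately show ?thesis using J(1,3)
      by (intro exI[of _ "insert 0 (Suc ` J)"] exI[of _ e']) (auto simp: e'_def b_def)
  qed
qed

text \<open>Flipping all signs turns a representation of t into one of -t, so the table only covers
  0 to \<open>h div 2\<close>.\<close>

lemma signed_sum_basisI:
  assumes W: "map (\<lambda>n. ternary_sum as n mod int h) W = [0..int h div 2]"
    and weight: "\<forall>n\<in>set W. ternary_weight as n = k"
    and half: "\<forall>a\<in>set as. \<not> int h dvd 2 * a" and h: "h > 0"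
  shows "signed_sum_basis h k as"
  unfolding signed_sum_basis_def
proof (intro conjI allI half)
  fix t
  have small: "\<exists>J e. J \<subseteq> {..<length as} \<and> card J = k \<and> (\<forall>j\<in>J. \<bar>e j\<bar> = 1) \<and>
      [(\<Sum>j\<in>J. e j * as ! j) = t] (mod int h)" if "t mod int h \<le> int h div 2" for t
  proof -
    have "t mod int h \<in> set (map (\<lambda>n. ternary_sum as n mod int h) W)"
      unfolding W using that h by simp
    then obtain n where "n \<in> set W" "[ternary_sum as n = t] (mod int h)"
      by (auto simp: cong_def)
    then show ?thesis using ternary_sum_eq[of as n] weight by metis
  qed
  show "\<exists>J e. J \<subseteq> {..<length as} \<and> card J = k \<and> (\<forall>j\<in>J. \<bar>e j\<bar> = 1) \<and>
      [(\<Sum>j\<in>J. e j * as ! j) = t] (mod int h)"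
  proof (cases "t mod int h \<le> int h div 2")
    case True
    then show ?thesis by (rule small)
  next
    case False
    then have "(- t) mod int h \<le> int h div 2"
      by (auto simp: zmod_zminus1_eq_if)
    from small[OF this] obtain J and e :: "nat \<Rightarrow> int" where
      J: "J \<subseteq> {..<length as}" "card J = k" "\<forall>j\<in>J. \<bar>e j\<bar> = 1"
      "[(\<Sum>j\<in>J. e j * as ! j) = - t] (mod int h)" by blast
    from J(4) have "[- (\<Sum>j\<in>J. e j * as ! j) = - (- t)] (mod int h)"
      by (simp only: cong_minus_minus_iff)
    then have "[(\<Sum>j\<in>J. - e j * as ! j) = t] (mod int h)"
      by (simp add: sum_negf)
    then show ?thesis using J(1-3)
      by (intro exI[of _ J] exI[of _ "\<lambda>j. - e j"]) auto
  qed
qed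

section \<open>Explicit bases for k = 3, 4, 5\<close>

lemma signed_sum_basis_57: "signed_sum_basis 57 3 [24, 28, 12, 13, 1]"
  by (rule signed_sum_basisI[where W = "[
    144, 38, 126, 75, 78, 86, 89, 13, 16, 34, 217, 181, 136, 100, 219, 183, 14, 17, 35, 218,
    182, 137, 101, 64, 198, 46, 117, 66, 69]"]; code_simp)

text \<open>An even modulus close to 57, for the limes inferior at k = 3, where odd degrees must be
  covered too.\<close>

lemma signed_sum_basis_56: "signed_sum_basis 56 3 [21, 5, 14, 19, 18]"
  by (rule signed_sum_basisI[where W = "[
    51, 174, 25, 32, 138, 234, 192, 58, 166, 102, 48, 62, 22, 144, 222, 198, 26, 172, 78, 186,
    136, 59, 167, 126, 219, 100, 23, 96, 42]"]; code_simp)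

lemma signed_sum_basis_150: "signed_sum_basis 150 4 [22, 19, 37, 58, 67, 47]"
  by (rule signed_sum_basisI[where W = "[
    353, 450, 588, 357, 308, 188, 140, 237, 518, 204, 235, 175, 142, 268, 80, 711, 112, 572,
    50, 396, 67, 409, 221, 334, 52, 512, 524, 104, 223, 528, 301, 120, 193, 106, 118, 477, 417,
    384, 582, 415, 227, 354, 545, 185, 352, 309, 290, 201, 307, 187, 139, 265, 77, 465, 44,
    344, 596, 435, 79, 360, 433, 571, 49, 98, 278, 147, 128, 525, 145, 132, 523, 103, 677, 332,
    429, 381]"]; code_simp)

lemma signed_sum_basis_436: "signed_sum_basis 436 5 [1, 15, 43, 48, 77, 109, 152]"
  by (rule signed_sum_basisI[where W = "[
    158, 1581, 157, 428, 322, 427, 1803, 2178, 1388, 1274, 1387, 953, 474, 952, 1238, 1405,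
    917, 1576, 916, 1733, 1789, 1732, 456, 1284, 1389, 581, 470, 580, 203, 1368, 202, 1578,
    320, 1266, 319, 2166, 452, 1280, 451, 1279, 2130, 950, 471, 949, 609, 809, 914, 808, 913,
    1261, 1786, 2161, 453, 1281, 2126, 960, 152, 1356, 151, 422, 604, 421, 1320, 1263, 440,
    942, 134, 1815, 133, 956, 1232, 955, 1231, 1351, 606, 806, 1316, 805, 1315, 938, 402, 937,
    2114, 1810, 2113, 957, 149, 1353, 148, 419, 313, 418, 1317, 1206, 398, 939, 131, 1812, 130,
    2019, 295, 1698, 908, 2151, 907, 1247, 1303, 926, 447, 925, 399, 2006, 2111, 2005, 2110,
    1359, 1970, 1693, 311, 1257, 310, 1194, 386, 888, 385, 1341, 1158, 350, 293, 349, 292, 800,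
    905, 799, 904, 1190, 1300, 884, 444, 883, 1154, 782, 1153, 781, 726, 1681, 1967, 2134,
    1311, 1254, 1645, 933, 125, 885, 124, 1050, 1155, 347, 722, 346, 721, 797, 1307, 796, 1306,
    872, 393, 871, 1142, 1046, 836, 779, 835, 778, 723, 1678, 375, 1538, 1308, 1197, 389, 930,
    122, 1326, 121, 1047, 286, 1689, 709, 1179, 371, 674, 370, 673, 2049, 869, 390, 868, 1139,
    1033, 833, 1685, 832, 1684, 997, 2080, 372, 1535, 2045, 879, 2044, 1332, 1149, 341, 284,
    340, 283, 1167, 359]"]; code_simp)

section \<open>Asymptotic bounds\<close>

text \<open>A signed sum s first matches v modulo h. Then (v - s) / h is represented modulo r^k by
  short multiples of the \<open>w l\<close>, and h times these multiples is absorbed into the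
  generators.\<close>

lemma ex_half_generators:
  assumes basis: "signed_sum_basis h k as" and h: "h > 0" and k: "k > 0"
  obtains N C :: nat where "N > 0"
    "\<And>r. \<lbrakk>[r = 1] (mod N); C < r\<rbrakk> \<Longrightarrow> \<exists>T. finite T \<and> card T \<le> length as * (r + C + 1) \<and>
       (\<forall>g\<in>T. \<not> int h dvd 2 * g) \<and>
       (\<forall>v. \<exists>gs. length gs = k \<and> set gs \<subseteq> T \<union> uminus ` T \<and> [sum_list gs = v] (mod int (h * r ^ k)))"
proof -
  define m where "m = length as"
  obtain N C where N: "N > 0" and ex: "\<And>r. \<lbrakk>[r = 1] (mod N); C < r\<rbrakk> \<Longrightarrow> \<exists>w :: nat \<Rightarrow> int.
       \<forall>J u. J \<subseteq> {..<m} \<and> card J = k \<longrightarrow>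
         (\<exists>x. (\<forall>l\<in>J. 2 * \<bar>x l\<bar> \<le> int (r + C)) \<and> [(\<Sum>l\<in>J. x l * w l) = u] (mod int r ^ k))"
    by (rule ex_directions[OF k, where m = m]) (rule that)
  show ?thesis
  proof (rule that[of N C])
    show "N > 0" by fact
    fix r assume "[r = 1] (mod N)" "C < r"
    from ex[OF this] obtain w :: "nat \<Rightarrow> int" where
      w: "\<And>J u. J \<subseteq> {..<m} \<Longrightarrow> card J = k \<Longrightarrow>
         \<exists>x. (\<forall>l\<in>J. 2 * \<bar>x l\<bar> \<le> int (r + C)) \<and> [(\<Sum>l\<in>J. x l * w l) = u] (mod int r ^ k)"
      by blast
    \<comment> \<open>2 |x| \<le> r + C means |x| \<le> b, which allows 2 b + 1 \<le> r + C + 1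
      values of x.\<close>
    define b where "b = int ((r + C) div 2)"
    define g where "g = (\<lambda>(l, x). as ! l + int h * (x * w l))"
    define T where "T = g ` ({..<m} \<times> {- b..b})"
    have "finite T" by (simp add: T_def)
    moreover have "card T \<le> m * (r + C + 1)"
    proof -
      have "card T \<le> card ({..<m} \<times> {- b..b})" unfolding T_def by (rule card_image_le) auto
      also have "\<dots> = m * nat (2 * b + 1)" by (simp add: card_cartesian_product)
      also have "\<dots> \<le> m * (r + C + 1)" unfolding b_def by (intro mult_left_mono) auto
      finally show ?thesis .
    qed
    moreover have "\<not> int h dvd 2 * t" if tT: "t \<in> T" for t
    proof -
      obtain l x where t: "l < m" "t = as ! l + int h * (x * w l)"
        using tT by (auto simp: T_def g_def)
      \<comment> \<open>Modulo h, the generator is just \<open>as ! l\<close>.\<close>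
      have "2 * t = 2 * (as ! l) + int h * (2 * x * w l)" by (simp add: t algebra_simps)
      then show ?thesis
        using basis t(1) by (simp add: signed_sum_basis_def m_def dvd_add_left_iff)
    qed
    moreover have "\<exists>gs. length gs = k \<and> set gs \<subseteq> T \<union> uminus ` T \<and> [sum_list gs = v] (mod int (h * r ^ k))" for v
    proof -
      obtain J e where J: "J \<subseteq> {..<m}" "card J = k" and e: "\<And>j. j \<in> J \<Longrightarrow> \<bar>e j\<bar> = 1"
        and Jv: "[(\<Sum>j\<in>J. e j * as ! j) = v] (mod int h)"
        using basis unfolding signed_sum_basis_def m_def by metis
      define s where "s = (\<Sum>j\<in>J. e j * as ! j)"
      have fin: "finite J" using J(1) finite_subset by blast
      obtain u where u: "v = s + int h * u" using Jv unfolding s_def by (metis cong_iff_lin)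
      obtain x where x: "\<And>l. l \<in> J \<Longrightarrow> 2 * \<bar>x l\<bar> \<le> int (r + C)"
        and xu: "[(\<Sum>l\<in>J. x l * w l) = u] (mod int r ^ k)"
        using w[OF J] by blast
      \<comment> \<open>The sign also multiplies \<open>x l\<close>: it squares to 1 there, so only
        the \<open>as ! l\<close> part is signed.\<close>
      define f where "f l = e l * g (l, e l * x l)" for l
      have f_in: "f l \<in> T \<union> uminus ` T" if "l \<in> J" for l
      proof -
        have "\<bar>e l * x l\<bar> \<le> b" using e[OF that] x[OF that] by (simp add: abs_mult b_def)
        then have "g (l, e l * x l) \<in> T" unfolding T_def using that J(1) by (intro imageI) (auto simp: abs_le_iff)
        moreover have "e l = 1 \<or> e l = -1" using e[OF that] by auto
        ultimately show ?thesis by (auto simp: f_def)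
      qed
      have f_eq: "f l = e l * as ! l + int h * (x l * w l)" if "l \<in> J" for l
        using e[OF that] by (auto simp: f_def g_def abs_if algebra_simps split: if_splits)
      have "sum_list (map f (sorted_list_of_set J)) = (\<Sum>l\<in>J. f l)"
        using fin by (simp add: sum_list_distinct_conv_sum_set)
      also have "\<dots> = s + int h * (\<Sum>l\<in>J. x l * w l)"
        by (simp add: f_eq s_def sum.distrib sum_distrib_left)
      finally have "sum_list (map f (sorted_list_of_set J)) = s + int h * (\<Sum>l\<in>J. x l * w l)" .
      moreover have "[int h * (\<Sum>l\<in>J. x l * w l) = int h * u] (mod int h * int r ^ k)"
        using xu by (simp add: cong_iff_dvd_diff flip: right_diff_distrib)
      ultimately have "[sum_list (map f (sorted_list_of_set J)) = v] (mod int (h * r ^ k))"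
        unfolding u by (simp add: cong_add_lcancel)
      then show ?thesis using fin J(2) f_in
        by (intro exI[of _ "map f (sorted_list_of_set J)"]) auto
    qed
    ultimately show "\<exists>T. finite T \<and> card T \<le> length as * (r + C + 1) \<and>
       (\<forall>g\<in>T. \<not> int h dvd 2 * g) \<and>
       (\<forall>v. \<exists>gs. length gs = k \<and> set gs \<subseteq> T \<union> uminus ` T \<and> [sum_list gs = v] (mod int (h * r ^ k)))"
      unfolding m_def by blast
  qed
qed

text \<open>T is folded into the residues below n / 2 and enlarged there to \<open>d div 2\<close>
  elements. Adding the mirror image, and n / 2 for odd d, gives exactly d elements.\<close>

lemma ex_connection_set:
  fixes T :: "int set"
  assumes T: "finite T" "card T \<le> d div 2" "\<And>g. g \<in> T \<Longrightarrow> \<not> int n dvd 2 * g"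
    and n: "d + 2 \<le> n" and parity: "odd d \<Longrightarrow> even n"
  obtains S where "S \<subseteq> {0<..<int n}" "card S = d" "\<And>s. s \<in> S \<Longrightarrow> int n - s \<in> S"
    "\<And>g. g \<in> T \<union> uminus ` T \<Longrightarrow> g mod int n \<in> S"
proof -
  define H where "H = {0<..(int n - 1) div 2}"
  have H: "x \<in> H \<longleftrightarrow> 0 < x \<and> 2 * x < int n" for x by (auto simp: H_def)
  have mods: "(- g) mod int n = int n - g mod int n" "0 < g mod int n" "g mod int n < int n"
    "2 * (g mod int n) \<noteq> int n" if "g \<in> T" for g
  proof -
    have nz: "g mod int n \<noteq> 0"
      using T(3)[OF that] by (metis dvd_mult mod_0_imp_dvd)
    then show "(- g) mod int n = int n - g mod int n" by (simp add: zmod_zminus1_eq_if)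
    show "0 < g mod int n" "g mod int n < int n"
      using nz n pos_mod_sign[of "int n" g] pos_mod_bound[of "int n" g] by linarith+
    show "2 * (g mod int n) \<noteq> int n"
    proof
      assume eq: "2 * (g mod int n) = int n"
      have "2 * g = 2 * (g mod int n) + int n * (2 * (g div int n))"
        by (simp add: algebra_simps flip: minus_mult_div_eq_mod)
      then show False using T(3)[OF that] unfolding eq by simp
    qed
  qed
  define rep where "rep g = min (g mod int n) (int n - g mod int n)" for g
  have "rep ` T \<subseteq> H"
  proof
    fix x assume "x \<in> rep ` T"
    then obtain g where g: "g \<in> T" "x = rep g" by blast
    show "x \<in> H" using mods(2-4)[OF g(1)] unfolding H g(2) rep_def by (auto simp: min_def)
  qed
  moreover have "card (rep ` T) \<le> d div 2" using card_image_le[OF T(1), of rep] T(2) by linarith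
  moreover have "d div 2 \<le> card H" unfolding H_def using n by simp
  moreover have "finite H" by (simp add: H_def)
  ultimately obtain B where B: "rep ` T \<subseteq> B" "B \<subseteq> H" "card B = d div 2"
    using exists_subset_between[of "rep ` T" "d div 2" H] by blast
  have finB: "finite B" using B(2) \<open>finite H\<close> finite_subset by blast
  \<comment> \<open>The residue n / 2 is the only nonzero one equal to its own negative, so it alone
    can make the size odd.\<close>
  define M where "M = (if odd d then {int n div 2} else {})"
  define S where "S = B \<union> (\<lambda>x. int n - x) ` B \<union> M"
  have M: "x \<in> M \<Longrightarrow> 2 * x = int n" for x
    using parity by (auto simp: M_def split: if_splits)
  have mirror: "x \<in> (\<lambda>x. int n - x) ` B \<Longrightarrow> 2 * x > int n" for x
    using B(2) H by auto
  have B_half: "x \<in> B \<Longrightarrow> 2 * x < int n" for x using B(2) H by auto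
  show ?thesis
  proof (rule that[of S])
    show "S \<subseteq> {0<..<int n}"
    proof
      fix x assume "x \<in> S"
      then show "x \<in> {0<..<int n}"
        using B(2) H M[of x] n unfolding S_def by fastforce
    qed
    have "card S = card (B \<union> (\<lambda>x. int n - x) ` B) + card M"
      unfolding S_def using finB M mirror B_half
      by (intro card_Un_disjoint) (force simp: M_def)+
    also have "card (B \<union> (\<lambda>x. int n - x) ` B) = card B + card ((\<lambda>x. int n - x) ` B)"
      using finB mirror B_half by (intro card_Un_disjoint) force+
    also have "card ((\<lambda>x. int n - x) ` B) = card B" by (intro card_image inj_onI) auto
    finally show "card S = d" using B(3) by (auto simp: M_def elim: oddE)
    show "int n - s \<in> S" if "s \<in> S" for s
    proof -
      have "int n - s = s" if "s \<in> M" using M[OF that] by simp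
      then show ?thesis using that by (auto simp: S_def)
    qed
    show "g mod int n \<in> S" if "g \<in> T \<union> uminus ` T" for g
    proof -
      have "t mod int n \<in> S \<and> (- t) mod int n \<in> S" if t: "t \<in> T" for t
      proof -
        have "rep t \<in> B" using B(1) t by blast
        then have "t mod int n \<in> B \<or> int n - t mod int n \<in> B"
          by (auto simp: rep_def min_def split: if_splits)
        then show ?thesis unfolding mods(1)[OF t] S_def by force
      qed
      then show ?thesis using that by auto
    qed
  qed
qed

text \<open>For given d, r is chosen as large as the degree permits within its class modulo N; it
  stays within a constant of d / (2 m), and n = h r^k is the order reached.\<close>

lemma eventually_CC_ge:
  assumes basis: "signed_sum_basis h k as" and h: "h > 0" and k: "k \<ge> 2" and as: "as \<noteq> []"
  obtains K :: real where
    "eventually (\<lambda>d. (odd d \<longrightarrow> even h) \<longrightarrow>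
       real h * (real d / (2 * real (length as)) - K) ^ k \<le> real (CC d k)) sequentially"
proof -
  define m where "m = length as"
  have m: "m > 0" using as by (simp add: m_def)
  obtain N C where N: "N > 0" and ex: "\<And>r. \<lbrakk>[r = 1] (mod N); C < r\<rbrakk> \<Longrightarrow>
     \<exists>T. finite T \<and> card T \<le> m * (r + C + 1) \<and> (\<forall>g\<in>T. \<not> int h dvd 2 * g) \<and>
       (\<forall>v. \<exists>gs. length gs = k \<and> set gs \<subseteq> T \<union> uminus ` T \<and> [sum_list gs = v] (mod int (h * r ^ k)))"
    using k unfolding m_def by (elim ex_half_generators[OF basis h, rotated]) (auto intro: that)
  \<comment> \<open>Rounding d / (2 m) down to \<open>D\<close> loses less than 1, and passing from
    \<open>D\<close> to r loses less than C + N + 2.\<close>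
  define K where "K = real (C + 3 + N)"
  \<comment> \<open>c is the limit of the lower bound divided by d^k, whereas (d + 1)^(k - 1) / d^k
    tends to 0. Comparing both with c / 2 puts n above the Moore bound for k - 1.\<close>
  define c where "c = real h * (1 / (2 * real m)) ^ k"
  have "c > 0" using h m by (simp add: c_def)
  have lim1: "(\<lambda>d. real h * (1 / (2 * real m) - K * (1 / real d)) ^ k) \<longlonglongrightarrow> real h * (1 / (2 * real m) - K * 0) ^ k"
    by (intro tendsto_intros lim_1_over_n)
  have lim2: "(\<lambda>d. (1 + 1 / real d) ^ (k - 1) * (1 / real d)) \<longlonglongrightarrow> (1 + 0) ^ (k - 1) * 0"
    by (intro tendsto_intros lim_1_over_n)
  have "eventually (\<lambda>d. c / 2 < real h * (1 / (2 * real m) - K * (1 / real d)) ^ k) sequentially"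
    using order_tendstoD(1)[OF lim1, of "c / 2"] \<open>c > 0\<close> by (simp add: c_def)
  moreover have "eventually (\<lambda>d. (1 + 1 / real d) ^ (k - 1) * (1 / real d) < c / 2) sequentially"
    using order_tendstoD(2)[OF lim2, of "c / 2"] \<open>c > 0\<close> by simp
  \<comment> \<open>This threshold ensures r > C and makes the base d / (2 m) - K nonnegative, as
    monotonicity of powers requires.\<close>
  moreover have "eventually (\<lambda>d. 2 * m * (2 * C + N + 5) \<le> d) sequentially" by (rule eventually_ge_at_top)
  ultimately have "eventually (\<lambda>d. (odd d \<longrightarrow> even h) \<longrightarrow>
       real h * (real d / (2 * real m) - K) ^ k \<le> real (CC d k)) sequentially"
  proof eventually_elim
    case (elim d)
    show ?case
    proof
      assume parity: "odd d \<longrightarrow> even h"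
      have d: "d > 0" using elim(3) m by (cases d) auto
      define D where "D = d div (2 * m)"
      have D: "2 * C + N + 5 \<le> D"
        using elim(3) m unfolding D_def by (simp add: less_eq_div_iff_mult_less_eq mult.commute)
      \<comment> \<open>Makes r the largest number that is 1 modulo N and satisfies r + C + 1 \<le>
        D.\<close>
      define q where "q = (D - C - 2) div N"
      define r where "r = N * q + 1"
      have "N * q \<le> D - C - 2" "D - C - 2 < N * q + N"
        using mult_div_mod_eq[of N "D - C - 2"] mod_less_divisor[OF N, of "D - C - 2"]
        unfolding q_def by linarith+
      then have r_le: "r + C + 1 \<le> D" and r_ge: "D < r + C + N + 2"
        using D by (auto simp: r_def)
      have "[N * q + 1 = 0 + 1] (mod N)"
        by (intro cong_add cong_refl) (simp add: cong_0_iff)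
      then have r1: "[r = 1] (mod N)" by (simp add: r_def)
      have rC: "C < r" using r_ge D by linarith
      obtain T where T: "finite T" "card T \<le> m * (r + C + 1)"
        "\<forall>g\<in>T. \<not> int h dvd 2 * g"
        and cover: "\<forall>v. \<exists>gs. length gs = k \<and> set gs \<subseteq> T \<union> uminus ` T \<and> [sum_list gs = v] (mod int (h * r ^ k))"
        using ex[OF r1 rC] by (elim exE conjE) (rule that)
      define n where "n = h * r ^ k"
      have "real d / (2 * real m) < real D + 1"
      proof -
        have "d < 2 * m * (D + 1)"
          using mult_div_mod_eq[of "2 * m" d] mod_less_divisor[of "2 * m" d] m
          unfolding D_def distrib_left by linarith
        then have "real d < real (2 * m * (D + 1))" by (simp only: of_nat_less_iff)
        then show ?thesis using m by (simp add: divide_less_eq algebra_simps)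
      qed
      then have rK: "real d / (2 * real m) - K \<le> real r"
        using r_ge unfolding K_def by linarith
      have K0: "real d / (2 * real m) - K \<ge> 0"
      proof -
        have "real (2 * m * (2 * C + N + 5)) \<le> real d" using elim(3) by (simp only: of_nat_le_iff)
        then have "real (2 * C + N + 5) \<le> real d / (2 * real m)"
          using m by (simp add: field_simps)
        then show ?thesis unfolding K_def by simp
      qed
      then have n_ge: "real h * (real d / (2 * real m) - K) ^ k \<le> real n"
        unfolding n_def using rK by (simp add: power_mono mult_left_mono)
      have "(1 + real d) ^ (k - 1) = (1 + 1 / real d) ^ (k - 1) * (1 / real d) * real d ^ k"
      proof -
        have "k = Suc (k - 1)" using k by simp
        then have "real d ^ k = real d ^ (k - 1) * real d" by (metis power_Suc2)
        then have "(1 + 1 / real d) ^ (k - 1) * (1 / real d) * real d ^ k = ((1 + 1 / real d) * real d) ^ (k - 1)"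
          using d by (simp add: power_mult_distrib)
        also have "(1 + 1 / real d) * real d = 1 + real d" using d by (simp add: distrib_right)
        finally show ?thesis by (rule sym)
      qed
      also have "\<dots> < real h * (1 / (2 * real m) - K * (1 / real d)) ^ k * real d ^ k"
        using d by (intro mult_strict_right_mono less_trans[OF elim(2,1)]) simp
      also have "\<dots> = real h * (real d / (2 * real m) - K) ^ k"
      proof -
        have "real d / (2 * real m) - K = (1 / (2 * real m) - K * (1 / real d)) * real d"
          using d by (simp add: left_diff_distrib)
        then show ?thesis by (simp only: power_mult_distrib mult.assoc)
      qed
      also have "\<dots> \<le> real n" by (rule n_ge)
      finally have "real ((d + 1) ^ (k - 1)) < real n" by (simp add: add.commute)
      then have n_gt: "(d + 1) ^ (k - 1) < n" by (simp only: of_nat_less_iff)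
      \<comment> \<open>Here k \<ge> 2 enters: the order leaves room for d nonzero residues.\<close>
      moreover have "d + 1 \<le> (d + 1) ^ (k - 1)" using k by (intro self_le_power) auto
      ultimately have dn: "d + 2 \<le> n" by linarith
      have card_T: "card T \<le> d div 2"
      proof -
        have "m * (r + C + 1) \<le> m * D" using r_le by (rule mult_left_mono) simp
        also have "m * D = (d div 2) div m * m" by (simp add: D_def div_mult2_eq)
        also have "\<dots> \<le> d div 2" by simp
        finally show ?thesis using T(2) by linarith
      qed
      have T_half: "\<not> int n dvd 2 * g" if "g \<in> T" for g
      proof
        assume "int n dvd 2 * g"
        moreover have "int h dvd int n" by (simp add: n_def)
        ultimately have "int h dvd 2 * g" using dvd_trans by blast
        then show False using T(3) that by blast
      qed
      have n_even: "even n" if "odd d" using parity that by (simp add: n_def)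
      obtain S where S: "S \<subseteq> {0<..<int n}" "card S = d" "\<And>s. s \<in> S \<Longrightarrow> int n - s \<in> S"
        "\<And>g. g \<in> T \<union> uminus ` T \<Longrightarrow> g mod int n \<in> S"
        by (rule ex_connection_set[OF T(1) card_T T_half dn n_even]) (assumption+, rule that)
      have "n \<le> CC d k"
      proof (rule CC_ge[OF n_gt _ S(1-3)])
        show "k > 0" using k by simp
        fix v
        obtain gs where gs: "length gs = k" "set gs \<subseteq> T \<union> uminus ` T" "[sum_list gs = v] (mod int n)"
          using cover[THEN spec, of v] unfolding n_def by blast
        have "[sum_list (map (\<lambda>g. g mod int n) xs) = sum_list xs] (mod int n)" for xs
          by (induction xs) (auto intro!: cong_add)
        then have "[sum_list (map (\<lambda>g. g mod int n) gs) = v] (mod int n)" using gs(3) cong_trans by blast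
        then show "\<exists>gs. length gs \<le> k \<and> set gs \<subseteq> S \<and> [sum_list gs = v] (mod int n)"
          using gs S(4) by (intro exI[of _ "map (\<lambda>g. g mod int n) gs"]) auto
      qed
      then show "real h * (real d / (2 * real m) - K) ^ k \<le> real (CC d k)"
        using n_ge by (meson of_nat_le_iff order_trans)
    qed
  qed
  then show ?thesis using that unfolding m_def by blast
qed

section \<open>Passage to the limits and to the roots\<close>

lemma shifted_power_ratio_tendsto:
  fixes b c K :: real
  shows "(\<lambda>d. ereal (c * (real d / b - K) ^ k / real d ^ k)) \<longlonglongrightarrow> ereal (c / b ^ k)"
proof -
  have "(\<lambda>d. c * (1 / b - K * (1 / real d)) ^ k) \<longlonglongrightarrow> c * (1 / b - K * 0) ^ k"
    by (intro tendsto_intros lim_1_over_n)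
  also have "c * (1 / b - K * 0) ^ k = c / b ^ k" by (simp add: power_divide)
  finally have lim: "(\<lambda>d. c * (1 / b - K * (1 / real d)) ^ k) \<longlonglongrightarrow> c / b ^ k" .
  have "eventually (\<lambda>d. c * (1 / b - K * (1 / real d)) ^ k = c * (real d / b - K) ^ k / real d ^ k) sequentially"
    using eventually_gt_at_top[of 0]
  proof eventually_elim
    case (elim d)
    then have "1 / b - K * (1 / real d) = (real d / b - K) / real d"
      by (simp add: diff_divide_distrib)
    then show ?case by (simp add: power_divide)
  qed
  with lim show ?thesis by (intro tendsto_ereal) (rule Lim_transform_eventually)
qed

lemma LC_minus_ge:
  assumes "signed_sum_basis h k as" "h > 0" "k \<ge> 2" "as \<noteq> []" "even h"
  shows "ereal (real h / (2 * real (length as)) ^ k) \<le> LC_minus k"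
proof -
  obtain K where K: "eventually (\<lambda>d. (odd d \<longrightarrow> even h) \<longrightarrow>
       real h * (real d / (2 * real (length as)) - K) ^ k \<le> real (CC d k)) sequentially"
    by (rule eventually_CC_ge[OF assms(1-4)]) (rule that)
  let ?f = "\<lambda>d. ereal (real h * (real d / (2 * real (length as)) - K) ^ k / real d ^ k)"
  have "ereal (real h / (2 * real (length as)) ^ k) = liminf ?f"
    by (rule lim_imp_Liminf[symmetric, OF _ shifted_power_ratio_tendsto]) simp
  also have "\<dots> \<le> LC_minus k"
    unfolding LC_minus_def by (rule Liminf_mono, use K in eventually_elim) (auto simp: assms(5) divide_right_mono)
  finally show ?thesis .
qed

text \<open>For odd h the estimate is available at even degrees; the subsequence of even d already
  bounds the limes superior from below.\<close>

lemma LC_plus_ge: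
  assumes "signed_sum_basis h k as" "h > 0" "k \<ge> 2" "as \<noteq> []"
  shows "ereal (real h / (2 * real (length as)) ^ k) \<le> LC_plus k"
proof -
  obtain K where K: "eventually (\<lambda>d. (odd d \<longrightarrow> even h) \<longrightarrow>
       real h * (real d / (2 * real (length as)) - K) ^ k \<le> real (CC d k)) sequentially"
    by (rule eventually_CC_ge[OF assms]) (rule that)
  let ?f = "\<lambda>d. ereal (real h * (real d / (2 * real (length as)) - K) ^ k / real d ^ k)"
  let ?g = "\<lambda>d. ereal (real (CC d k) / real d ^ k)"
  have even: "strict_mono ((*) (2::nat))" by (rule strict_monoI) simp
  have "(?f \<circ> (*) 2) \<longlonglongrightarrow> ereal (real h / (2 * real (length as)) ^ k)"
    by (rule LIMSEQ_subseq_LIMSEQ[OF shifted_power_ratio_tendsto even])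
  then have "ereal (real h / (2 * real (length as)) ^ k) = limsup (?f \<circ> (*) 2)"
    by (rule lim_imp_Limsup[symmetric, rotated]) simp
  also have "\<dots> \<le> limsup (?g \<circ> (*) 2)"
    by (rule Limsup_mono, use eventually_subseq[OF even K] in eventually_elim)
      (auto simp del: of_nat_mult intro!: divide_right_mono)
  also have "\<dots> \<le> LC_plus k"
    unfolding LC_plus_def by (rule limsup_subseq_mono[OF even])
  finally show ?thesis .
qed

lemma LC_minus_le_LC_plus: "LC_minus k \<le> LC_plus k"
  unfolding LC_minus_def LC_plus_def by (rule Liminf_le_Limsup) simp

text \<open>A crude form of the Moore bound, using d + 1 \<le> 2 d. It serves to exclude the value
  \<infinity>, which \<open>real_of_ereal\<close> would send to 0.\<close>

lemma LC_plus_le: "LC_plus k \<le> ereal (2 ^ k)"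
  unfolding LC_plus_def
proof (rule Limsup_bounded, use eventually_gt_at_top[of "0::nat"] in eventually_elim)
  case (elim d)
  have "real (CC d k) \<le> real ((d + 1) ^ k)" using CC_le by (simp only: of_nat_le_iff)
  also have "\<dots> \<le> (2 * real d) ^ k"
    using elim unfolding of_nat_power by (intro power_mono) auto
  finally show ?case using elim by (simp add: divide_le_eq power_mult_distrib)
qed

lemma LC_minus_nonneg: "0 \<le> LC_minus k"
  unfolding LC_minus_def by (rule Liminf_bounded) simp

lemma RC_minus_le_RC_plus: "RC_minus k \<le> RC_plus k"
proof (cases "k = 0")
  case False
  have "LC_plus k \<noteq> \<infinity>" using LC_plus_le[of k] by auto
  then have "real_of_ereal (LC_minus k) \<le> real_of_ereal (LC_plus k)"
    by (intro real_of_ereal_positive_mono LC_minus_nonneg LC_minus_le_LC_plus)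
  then show ?thesis
    using False unfolding RC_minus_def RC_plus_def
    by (intro mult_left_mono) auto
qed (simp add: RC_minus_def RC_plus_def)

text \<open>Reduces a numerical bound on the root to the rational comparison (x / k)^k < a; the
  bound b makes L finite.\<close>

lemma scaled_root_greater:
  assumes "k > 0" "0 \<le> x" "(x / real k) ^ k < a" "ereal a \<le> L" "L \<le> ereal b"
  shows "x < real k * root k (real_of_ereal L)"
proof -
  have "a \<le> real_of_ereal L" using assms(4,5) by (cases L) auto
  then have "(x / real k) ^ k < real_of_ereal L" using assms(3) by simp
  then have "root k ((x / real k) ^ k) < root k (real_of_ereal L)"
    using assms(1) by simp
  then have "x / real k < root k (real_of_ereal L)"
    using assms(1,2) by (simp add: real_root_power_cancel)
  then show ?thesis using assms(1) by (simp add: divide_less_eq mult.commute)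
qed


theorem theorem8:
  shows "(LC_plus 3 \<ge> ereal (57 / 1000) \<and> LC_minus 3 \<ge> ereal (7 / 125) \<and>
          RC_plus 3 > 1.15455 \<and> RC_minus 3 > 1.14775) \<and>
         (LC_plus 4 \<ge> LC_minus 4 \<and> LC_minus 4 \<ge> ereal (25 / 3456) \<and>
          RC_plus 4 \<ge> RC_minus 4 \<and> RC_minus 4 > 1.16654) \<and>
         (LC_plus 5 \<ge> LC_minus 5 \<and> LC_minus 5 \<ge> ereal (109 / 134456) \<and>
          RC_plus 5 \<ge> RC_minus 5 \<and> RC_minus 5 > 1.20431)"
proof -
  \<comment> \<open>The values of h / (2 m)^k are 57/10^3, 56/10^3, 150/12^4 and 436/14^5, for bases
    with 5, 5, 6 and 7 entries.\<close>
  have L3: "ereal (57 / 1000) \<le> LC_plus 3" "ereal (7 / 125) \<le> LC_minus 3"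
    using LC_plus_ge[OF signed_sum_basis_57] LC_minus_ge[OF signed_sum_basis_56] by simp_all
  have L4: "ereal (25 / 3456) \<le> LC_minus 4" using LC_minus_ge[OF signed_sum_basis_150] by simp
  have L5: "ereal (109 / 134456) \<le> LC_minus 5" using LC_minus_ge[OF signed_sum_basis_436] by simp
  have le: "LC_minus k \<le> ereal (2 ^ k)" for k
    using LC_minus_le_LC_plus LC_plus_le by (rule order_trans)
  have R: "1.15455 < RC_plus 3" "1.14775 < RC_minus 3" "1.16654 < RC_minus 4" "1.20431 < RC_minus 5"
    unfolding RC_plus_def RC_minus_def
    subgoal by (rule scaled_root_greater[OF _ _ _ L3(1) LC_plus_le]) (simp_all add: power_divide)
    subgoal by (rule scaled_root_greater[OF _ _ _ L3(2) le]) (simp_all add: power_divide)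
    subgoal by (rule scaled_root_greater[OF _ _ _ L4 le]) (simp_all add: power_divide)
    subgoal by (rule scaled_root_greater[OF _ _ _ L5 le]) (simp_all add: power_divide)
    done
  show ?thesis
    by (intro conjI L3 L4 L5 R LC_minus_le_LC_plus RC_minus_le_RC_plus)
qed

end
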